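(* Let $q\in[0,2]$ and consider the loss $\ell_q(\hat r,r)$, where $\hat r$ is the least-squares estimator $$\hat r=\mathop{\mathrm{argmin}}_{r\in\mathcal R}\sum_{1\le i\ne j\le n}\left(X_{ij}-\mu_{r(i)r(j)}\right)^2 .$$ Under the noise condition (N) and the signal condition (S), $$\sup_{r\in\mathcal R}\mathbb E_r\,\ell_q(\hat r,r)\lesssim\begin{cases}\exp\left(-(1+o(1))\frac{n\beta^2}{4\sigma^2}\right), & \frac{n\beta^2}{4\sigma^2}>1,\\[4pt] \left\{\left(\frac{n\beta^2}{4\sigma^2}\right)^{-1}\log\left[\left(\frac{n\beta^2}{4\sigma^2}\right)^{-1}\right]\right\}^{q/2}\wedge n^q, & \frac{n\beta^2}{4\sigma^2}\le 1,\end{cases}$$ where $o(1)$ denotes a vanishing sequence as $n\to\infty$.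
   Context: Write $[n]=\{1,\dots,n\}$, $a\wedge b=\min(a,b)$, and let $\|\cdot\|$ be the Euclidean norm on $\mathbb R^n$. For positive sequences, $a_n\lesssim b_n$ means that $a_n\le Cb_n$ for all $n$ with some constant $C>0$ independent of $n$. Rank space: $\mathcal R=\{r=(r(1),\dots,r(n))\in[n]^n:\ |\sum_{i=1}^n r(i)-\sum_{i=1}^n i|\le c_n\}$, where $c_n$ satisfies $1\le c_n=o(\sqrt n)$. Model: $(\mu_{kl})_{k,l\in[n]}$ is a known real array. For $r\in\mathcal R$, $\mathbb P_r$ (with expectation $\mathbb E_r$) is the law of the observations $\{X_{ij}\}_{1\le i\ne j\le n}$ given by $X_{ij}=\mu_{r(i)r(j)}+Z_{ij}$. (N) Noise condition, with noise level $\sigma>0$: for every $t>0$ and all reals $(v_{ij})_{1\le i\neq j\le n}$ with $\sum_{1\le i\ne j\le n}v_{ij}^2=1$, $\mathbb P\left(\sum_{1\le i\ne j\le n}v_{ij}Z_{ij}>t\right)\le\exp\left(-\frac{t^2}{2\sigma^2}\right)$. (S) Signal condition, with a number $\beta\in\mathbb R$: for all $r,\tilde r\in\mathcal R$, $\sum_{1\le i\ne j\le n}\left(\mu_{\tilde r(i)\tilde r(j)}-\mu_{r(i)r(j)}\right)^2\ge 2n\beta^2\|\tilde r-r\|^2$. Loss: $\ell_0(\hat r,r)=\frac1n\sum_{i=1}^n\mathbb I\{\hat r(i)\ne r(i)\}$, where $\mathbb I$ is the indicator function, and $\ell_q(\hat r,r)=\frac1n\sum_{i=1}^n|\hat r(i)-r(i)|^q$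 for $q\in(0,2]$.
   Formalization: For nβ²/(4σ²) ≤ 1 the factor log[(nβ²/(4σ²))^{-1}] is replaced by max(1, log[·]), since the stated bound is 0 at nβ²/(4σ²) = 1 (q > 0) while the risk there can be positive; at β = 0 the bound is read as n^q. *)

theory Defs
  imports "HOL-Probability.Probability" "HOL-Library.Landau_Symbols"
begin

definition offdiag :: "nat \<Rightarrow> (nat \<times> nat) set" where
  "offdiag n = {(i, j). i \<in> {1..n} \<and> j \<in> {1..n} \<and> i \<noteq> j}"

text \<open>Rank vectors are extensional functions on \<open>{1..n}\<close>, so that two of them are equal
  iff they agree on \<open>{1..n}\<close>.\<close>

definition rank_space :: "nat \<Rightarrow> real \<Rightarrow> (nat \<Rightarrow> nat) set" where
  "rank_space n c = {r \<in> {1..n} \<rightarrow>\<^sub>E {1..n}. \<bar>(\<Sum>i=1..n. real (r i)) - (\<Sum>i=1..n. real i)\<bar> \<le> c}"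

text \<open>An observation array \<open>(x\<^sub>i\<^sub>j)\<close>, \<open>i \<noteq> j\<close>, is a function on \<open>offdiag n\<close>. \<open>obs_law n M \<mu> Z r\<close>
  is the law written \<open>P\<^sub>r\<close>; the noise variables \<open>Z\<^sub>i\<^sub>j\<close> live on a probability space \<open>M\<close> and need
  not be independent.\<close>

definition obs_space :: "nat \<Rightarrow> (nat \<times> nat \<Rightarrow> real) measure" where
  "obs_space n = (\<Pi>\<^sub>M p\<in>offdiag n. borel)"

definition obs_law ::
  "nat \<Rightarrow> 'a measure \<Rightarrow> (nat \<Rightarrow> nat \<Rightarrow> real) \<Rightarrow> (nat \<times> nat \<Rightarrow> 'a \<Rightarrow> real) \<Rightarrow> (nat \<Rightarrow> nat)
    \<Rightarrow> (nat \<times> nat \<Rightarrow> real) measure" where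
  "obs_law n M \<mu> Z r =
    distr M (obs_space n) (\<lambda>\<omega>. \<lambda>(i, j)\<in>offdiag n. \<mu> (r i) (r j) + Z (i, j) \<omega>)"

definition noise_condition ::
  "nat \<Rightarrow> 'a measure \<Rightarrow> (nat \<times> nat \<Rightarrow> 'a \<Rightarrow> real) \<Rightarrow> real \<Rightarrow> bool" where
  "noise_condition n M Z \<sigma> \<longleftrightarrow>
    (\<forall>t>0. \<forall>v. (\<Sum>p\<in>offdiag n. (v p)\<^sup>2) = 1 \<longrightarrow>
      measure M {\<omega> \<in> space M. (\<Sum>p\<in>offdiag n. v p * Z p \<omega>) > t} \<le> exp (- (t\<^sup>2 / (2 * \<sigma>\<^sup>2))))"

definition signal_condition :: "nat \<Rightarrow> real \<Rightarrow> (nat \<Rightarrow> nat \<Rightarrow> real) \<Rightarrow> real \<Rightarrow> bool" where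
  "signal_condition n c \<mu> \<beta> \<longleftrightarrow>
    (\<forall>r\<in>rank_space n c. \<forall>r'\<in>rank_space n c.
      (\<Sum>(i, j)\<in>offdiag n. (\<mu> (r' i) (r' j) - \<mu> (r i) (r j))\<^sup>2)
        \<ge> 2 * real n * \<beta>\<^sup>2 * (L2_set (\<lambda>i. real (r' i) - real (r i)) {1..n})\<^sup>2)"

definition loss :: "real \<Rightarrow> nat \<Rightarrow> (nat \<Rightarrow> nat) \<Rightarrow> (nat \<Rightarrow> nat) \<Rightarrow> real" where
  "loss q n r' r =
    (if q = 0 then 1 / real n * (\<Sum>i=1..n. if r' i \<noteq> r i then 1 else 0)
     else 1 / real n * (\<Sum>i=1..n. \<bar>real (r' i) - real (r i)\<bar> powr q))"

text \<open>A least-squares estimator is any measurable choice of a minimiser, so ties may be broken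
  arbitrarily.\<close>

definition least_squares_estimator ::
  "nat \<Rightarrow> real \<Rightarrow> (nat \<Rightarrow> nat \<Rightarrow> real) \<Rightarrow> ((nat \<times> nat \<Rightarrow> real) \<Rightarrow> (nat \<Rightarrow> nat)) \<Rightarrow> bool" where
  "least_squares_estimator n c \<mu> rhat \<longleftrightarrow>
    rhat \<in> measurable (obs_space n) (count_space (rank_space n c)) \<and>
    (\<forall>x\<in>space (obs_space n).
      is_arg_min (\<lambda>r. \<Sum>(i, j)\<in>offdiag n. (x (i, j) - \<mu> (r i) (r j))\<^sup>2)
        (\<lambda>r. r \<in> rank_space n c) (rhat x))"

definition max_risk ::
  "real \<Rightarrow> nat \<Rightarrow> real \<Rightarrow> 'a measure \<Rightarrow> (nat \<Rightarrow> nat \<Rightarrow> real) \<Rightarrow> (nat \<times> nat \<Rightarrow> 'a \<Rightarrow> real)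
    \<Rightarrow> ((nat \<times> nat \<Rightarrow> real) \<Rightarrow> (nat \<Rightarrow> nat)) \<Rightarrow> real" where
  "max_risk q n c M \<mu> Z rhat =
    (SUP r\<in>rank_space n c. \<integral>x. loss q n (rhat x) r \<partial>(obs_law n M \<mu> Z r))"

text \<open>The rate as a function of \<open>s = n \<beta>\<^sup>2 / (4 \<sigma>\<^sup>2)\<close>, with \<open>d\<close> in the place of the \<open>o(1)\<close> term.

  For \<open>s = 0\<close> the expression \<open>{s\<^sup>-\<^sup>1 log s\<^sup>-\<^sup>1}\<^sup>q\<^sup>/\<^sup>2 \<and> n\<^sup>q\<close> is read with \<open>s\<^sup>-\<^sup>1 = \<infinity>\<close>, i.e. as \<open>n\<^sup>q\<close>
  (in HOL, \<open>inverse 0 = 0\<close>).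

  The logarithm is truncated below at 1, as usual in rates that hold up to a constant factor.
  For \<open>s \<le> exp (- 1)\<close> this is \<open>log s\<^sup>-\<^sup>1\<close> itself, and for \<open>s \<le> s0 < 1\<close> it is at most
  \<open>max 1 (1 / log s0\<^sup>-\<^sup>1)\<close> times \<open>log s\<^sup>-\<^sup>1\<close>. Untruncated, the rate for \<open>q > 0\<close> would vanish as \<open>s\<close>
  increases to 1, where the risk does not vanish.\<close>

definition rate :: "real \<Rightarrow> nat \<Rightarrow> real \<Rightarrow> real \<Rightarrow> real" where
  "rate q n d s =
    (if s > 1 then exp (- (1 + d) * s)
     else if s = 0 then real n powr q
     else min ((inverse s * max 1 (ln (inverse s))) powr (q / 2)) (real n powr q))"

end

theory Submission
  imports Defs
begin

text \<open>Write \<open>s = n \<beta>\<^sup>2 / (4 \<sigma>\<^sup>2)\<close> and \<open>D(r') = \<parallel>r' - r\<parallel>\<^sup>2\<close> for the true rank vector \<open>r\<close>.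
  If the least-squares estimator selects \<open>r'\<close>, then the noise in the direction of
  \<open>\<mu>\<^bsub>r'\<^esub> - \<mu>\<^bsub>r\<^esub>\<close> is at least half the length of this difference, so the two conditions give
  \<open>P(rhat = r') \<le> exp (- s D(r'))\<close> (lemma \<open>selection_prob_le\<close>). Hence, for \<open>0 < \<theta> < s\<close>,
  \<open>E exp (\<theta> D(rhat)) \<le> \<Sum>\<^bsub>r'\<^esub> exp (- (s - \<theta>) D(r'))\<close>, and since \<open>D\<close> is a sum over coordinates, the
  right-hand side is at most a product of \<open>n\<close> one-dimensional Gaussian sums, each bounded by
  \<open>1 + 2 / (exp (s - \<theta>) - 1)\<close> (lemma \<open>sum_exp_sq_dist_le\<close>). Jensen's inequality for \<open>exp\<close> then yields
  \<open>E D(rhat) \<le> (n / \<theta>) ln (1 + 2 / (exp (s - \<theta>) - 1))\<close> (lemma \<open>expected_sq_dist_le\<close>).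

  For \<open>s > 1\<close> the choice \<open>\<theta> = 1/2\<close> bounds \<open>E D(rhat) / n\<close> by a multiple of \<open>exp (- s)\<close>; the loss is at
  most \<open>D / n\<close> because the ranks are integers, so the claim holds with \<open>\<delta> = 0\<close>. For \<open>0 < s \<le> 1\<close> the choice
  \<open>\<theta> = s/2\<close> bounds \<open>E D(rhat) / n\<close> by a multiple of \<open>s\<^sup>-\<^sup>1 max 1 (ln s\<^sup>-\<^sup>1)\<close>, and the concavity of
  \<open>x \<mapsto> x\<^bsup>q/2\<^esup>\<close> transfers the bound to the loss \<open>\<ell>\<^sub>q\<close>. The bound
  \<open>n\<^sup>q\<close>, which also covers \<open>s = 0\<close>, is trivial.\<close>

section \<open>Squared distance and the losses\<close>

text \<open>The squared Euclidean distance of two rank vectors.\<close>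

definition sq_dist :: "nat \<Rightarrow> (nat \<Rightarrow> nat) \<Rightarrow> (nat \<Rightarrow> nat) \<Rightarrow> real" where
  "sq_dist n r' r = (\<Sum>i=1..n. (real (r' i) - real (r i))\<^sup>2)"

lemma sq_dist_nonneg: "0 \<le> sq_dist n r' r"
  unfolding sq_dist_def by (intro sum_nonneg) auto

lemma L2_set_eq_sq_dist: "(L2_set (\<lambda>i. real (r' i) - real (r i)) {1..n})\<^sup>2 = sq_dist n r' r"
  unfolding L2_set_def sq_dist_def by (intro real_sqrt_pow2 sum_nonneg) auto

lemma finite_rank_space: "finite (rank_space n c)"
  unfolding rank_space_def
  by (rule finite_subset[OF _ finite_PiE[of "{1..n}" "\<lambda>_. {1..n}"]]) auto

lemma finite_offdiag: "finite (offdiag n)"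
  by (rule finite_subset[of _ "{1..n} \<times> {1..n}"]) (auto simp: offdiag_def)

lemma rank_space_nonempty:
  assumes "0 \<le> c"
  shows "rank_space n c \<noteq> {}"
proof -
  have "(\<lambda>i\<in>{1..n}. i) \<in> rank_space n c"
    using assms unfolding rank_space_def by auto
  then show ?thesis by blast
qed

lemma rank_space_range:
  assumes "r \<in> rank_space n c" and "i \<in> {1..n}"
  shows "r i \<in> {1..n}"
  using assms unfolding rank_space_def by (auto simp: PiE_iff)

lemma loss_le_sum:
  assumes "\<And>i. i \<in> {1..n} \<Longrightarrow> (if q = 0 then (if r' i \<noteq> r i then 1 else 0)
      else \<bar>real (r' i) - real (r i)\<bar> powr q) \<le> g i"
  shows "loss q n r' r \<le> 1 / real n * (\<Sum>i=1..n. g i)"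
proof (cases "q = 0")
  case True
  then show ?thesis
    unfolding loss_def using assms by (auto intro!: mult_left_mono sum_mono divide_right_mono)
next
  case False
  then show ?thesis
    unfolding loss_def using assms by (auto intro!: mult_left_mono sum_mono divide_right_mono)
qed

lemma loss_le_sq_dist:
  assumes "0 \<le> q" "q \<le> 2"
  shows "loss q n r' r \<le> sq_dist n r' r / real n"
proof -
  have "(if q = 0 then (if r' i \<noteq> r i then 1 else 0) else \<bar>real (r' i) - real (r i)\<bar> powr q)
      \<le> (real (r' i) - real (r i))\<^sup>2" for i
  proof (cases "r' i = r i")
    case False
    \<comment> \<open>distinct ranks differ by at least 1, so a larger exponent gives a larger power\<close>
    then have ge1: "1 \<le> \<bar>real (r' i) - real (r i)\<bar>" by linarith
    then have "\<bar>real (r' i) - real (r i)\<bar> powr q \<le> \<bar>real (r' i) - real (r i)\<bar> powr 2"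
      using assms by (intro powr_mono) auto
    also have "\<dots> = (real (r' i) - real (r i))\<^sup>2"
      using ge1 by (subst powr_numeral) auto
    finally have "\<bar>real (r' i) - real (r i)\<bar> powr q \<le> (real (r' i) - real (r i))\<^sup>2" .
    moreover have "\<bar>real (r' i) - real (r i)\<bar> powr 0 = 1" using ge1 by simp
    ultimately show ?thesis by auto
  qed auto
  from loss_le_sum[OF this] show ?thesis unfolding sq_dist_def by simp
qed

text \<open>A linearised form of the concavity of \<open>x \<mapsto> x\<^bsup>q/2\<^esup>\<close> at scale \<open>m\<close>, which makes the expected
  loss controllable through the expected squared distance.\<close>

lemma loss_le_affine_sq_dist:
  assumes "0 \<le> q" "q \<le> 2" "0 < m" "1 \<le> n"
  shows "loss q n r' r \<le> m powr (q / 2) * (1 + sq_dist n r' r / (real n * m))"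
proof -
  have affine: "x powr (q / 2) \<le> m powr (q / 2) * (1 + x / m)" if "0 \<le> x" for x :: real
  proof -
    have "(x / m) powr (q / 2) \<le> 1 + x / m"
    proof (cases "x / m \<le> 1")
      case True
      then have "(x / m) powr (q / 2) \<le> 1"
        using assms that by (intro powr_le1) auto
      moreover have "0 \<le> x / m" using that assms by simp
      ultimately show ?thesis by linarith
    next
      case False
      then have "(x / m) powr (q / 2) \<le> (x / m) powr 1"
        using assms by (intro powr_mono) auto
      with False show ?thesis by simp
    qed
    then have "m powr (q / 2) * (x / m) powr (q / 2) \<le> m powr (q / 2) * (1 + x / m)"
      by (intro mult_left_mono) auto
    then show ?thesis using assms that by (simp add: powr_divide)
  qed
  have "(if q = 0 then (if r' i \<noteq> r i then 1 else 0) else \<bar>real (r' i) - real (r i)\<bar> powr q)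
      \<le> m powr (q / 2) * (1 + (real (r' i) - real (r i))\<^sup>2 / m)" for i
  proof (cases "q = 0")
    case True
    have "0 \<le> (real (r' i) - real (r i))\<^sup>2 / m" using assms by simp
    with True \<open>0 < m\<close> show ?thesis by auto
  next
    case False
    have "\<bar>real (r' i) - real (r i)\<bar> powr q = ((real (r' i) - real (r i))\<^sup>2) powr (q / 2)"
    proof (cases "r' i = r i")
      case neq: False
      then have sq: "(real (r' i) - real (r i))\<^sup>2 = \<bar>real (r' i) - real (r i)\<bar> powr 2"
        by (subst powr_numeral) auto
      show ?thesis by (simp only: sq powr_powr) simp
    qed simp
    with False affine[of "(real (r' i) - real (r i))\<^sup>2"] show ?thesis by simp
  qed
  from loss_le_sum[OF this]
  have "loss q n r' r
      \<le> 1 / real n * (\<Sum>i=1..n. m powr (q / 2) * (1 + (real (r' i) - real (r i))\<^sup>2 / m))" .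
  also have "\<dots> = 1 / real n * (m powr (q / 2) * (real n + sq_dist n r' r / m))"
    unfolding sum_distrib_left[symmetric] sum.distrib sq_dist_def sum_divide_distrib by simp
  also have "\<dots> = m powr (q / 2) * (1 + sq_dist n r' r / (real n * m))"
    using assms by (simp add: field_simps)
  finally show ?thesis .
qed

lemma loss_le_powr:
  assumes "0 \<le> q" "1 \<le> n" "r \<in> rank_space n c" "r' \<in> rank_space n c"
  shows "loss q n r' r \<le> real n powr q"
proof -
  have "(if q = 0 then (if r' i \<noteq> r i then 1 else 0) else \<bar>real (r' i) - real (r i)\<bar> powr q)
      \<le> real n powr q" if "i \<in> {1..n}" for i
  proof -
    have "\<bar>real (r' i) - real (r i)\<bar> \<le> real n"
      using rank_space_range[OF assms(3) that] rank_space_range[OF assms(4) that] by auto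
    then show ?thesis using assms by (auto intro!: powr_mono2)
  qed
  from loss_le_sum[of n q r' r "\<lambda>_. real n powr q", OF this] show ?thesis using assms by simp
qed

section \<open>Gaussian sums over rank vectors\<close>

lemma sum_power_inj_le:
  fixes x :: real
  assumes "finite A" "inj_on f A" "\<And>k. k \<in> A \<Longrightarrow> 1 \<le> f k" "0 \<le> x" "x < 1"
  shows "(\<Sum>k\<in>A. x ^ f k) \<le> x / (1 - x)"
proof -
  have "(\<Sum>k\<in>A. x ^ f k) = x * (\<Sum>k\<in>A. x ^ (f k - 1))"
    unfolding sum_distrib_left
    by (intro sum.cong refl) (metis assms(3) power_minus_mult less_le_trans zero_less_one mult.commute)
  also have "(\<Sum>k\<in>A. x ^ (f k - 1)) = (\<Sum>m\<in>(\<lambda>k. f k - 1) ` A. x ^ m)"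
  proof -
    have "inj_on (\<lambda>k. f k - 1) A"
      using assms(2,3) unfolding inj_on_def by (metis le_add_diff_inverse)
    then show ?thesis by (simp add: sum.reindex)
  qed
  also have "\<dots> \<le> (\<Sum>m. x ^ m)"
    using assms by (intro sum_le_suminf) (auto simp: summable_geometric)
  also have "\<dots> = 1 / (1 - x)"
    using assms by (intro suminf_geometric) auto
  finally show ?thesis using assms by (simp add: mult_left_mono)
qed

lemma sum_exp_sq_diff_le:
  fixes \<kappa> :: real
  assumes "0 < \<kappa>"
  shows "(\<Sum>k=1..n. exp (- \<kappa> * (real k - real j)\<^sup>2)) \<le> 1 + 2 / (exp \<kappa> - 1)"
proof -
  define x where "x = exp (- \<kappa>)"
  have x: "0 \<le> x" "x < 1" and x_div: "x / (1 - x) = 1 / (exp \<kappa> - 1)"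
    using assms by (auto simp: x_def exp_minus field_simps)
  let ?e = "\<lambda>k. exp (- \<kappa> * (real k - real j)\<^sup>2)"
  have term_le: "?e k \<le> x ^ m" if "real m = \<bar>real k - real j\<bar>" for k m
  proof -
    have "real m \<le> (real m)\<^sup>2" by (cases m) (auto simp: power2_eq_square)
    then have "real m \<le> (real k - real j)\<^sup>2" by (simp add: that)
    then have "?e k \<le> exp (real m * (- \<kappa>))" using assms by (simp add: mult.commute)
    then show ?thesis unfolding x_def exp_of_nat_mult .
  qed
  have "(\<Sum>k=1..n. ?e k) \<le> (\<Sum>k\<in>{1..<j} \<union> {j} \<union> {j<..n}. ?e k)"
    by (intro sum_mono2) auto
  also have "\<dots> = (\<Sum>k\<in>{1..<j}. ?e k) + 1 + (\<Sum>k\<in>{j<..n}. ?e k)"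
    by (subst sum.union_disjoint; (subst sum.union_disjoint)?) auto
  also have "(\<Sum>k\<in>{1..<j}. ?e k) \<le> (\<Sum>k\<in>{1..<j}. x ^ (j - k))"
    by (intro sum_mono term_le) auto
  also have "\<dots> \<le> x / (1 - x)"
    using x by (intro sum_power_inj_le) (auto simp: inj_on_def)
  also have "(\<Sum>k\<in>{j<..n}. ?e k) \<le> (\<Sum>k\<in>{j<..n}. x ^ (k - j))"
    by (intro sum_mono term_le) auto
  also have "\<dots> \<le> x / (1 - x)"
    using x by (intro sum_power_inj_le) (auto simp: inj_on_def)
  finally show ?thesis unfolding x_div by simp
qed

lemma sum_exp_sq_dist_le:
  fixes \<kappa> :: real
  assumes "0 < \<kappa>"
  shows "(\<Sum>r'\<in>rank_space n c. exp (- \<kappa> * sq_dist n r' r)) \<le> (1 + 2 / (exp \<kappa> - 1)) ^ n"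
proof -
  have "(\<Sum>r'\<in>rank_space n c. exp (- \<kappa> * sq_dist n r' r))
      \<le> (\<Sum>r'\<in>{1..n} \<rightarrow>\<^sub>E {1..n}. exp (- \<kappa> * sq_dist n r' r))"
    by (intro sum_mono2 finite_PiE) (auto simp: rank_space_def)
  also have "\<dots> = (\<Sum>r'\<in>{1..n} \<rightarrow>\<^sub>E {1..n}. \<Prod>i\<in>{1..n}. exp (- \<kappa> * (real (r' i) - real (r i))\<^sup>2))"
    unfolding sq_dist_def sum_distrib_left by (simp add: exp_sum)
  also have "\<dots> = (\<Prod>i\<in>{1..n}. \<Sum>k\<in>{1..n}. exp (- \<kappa> * (real k - real (r i))\<^sup>2))"
    by (rule prod_sum_PiE[symmetric]) auto
  also have "\<dots> \<le> (\<Prod>i\<in>{1..n}. 1 + 2 / (exp \<kappa> - 1))"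
    using assms by (intro prod_mono conjI sum_nonneg sum_exp_sq_diff_le) auto
  finally show ?thesis by simp
qed

section \<open>Probability of selecting a given rank vector\<close>

text \<open>The noise condition in unnormalised form, and for the non-strict inequality.\<close>

lemma noise_tail_le:
  assumes "prob_space M" and Z: "\<forall>p\<in>offdiag n. Z p \<in> borel_measurable M"
    and \<sigma>: "0 < \<sigma>" and noise: "noise_condition n M Z \<sigma>"
    and V: "V = (\<Sum>p\<in>offdiag n. (v p)\<^sup>2)"
  shows "measure M {\<omega> \<in> space M. V / 2 \<le> (\<Sum>p\<in>offdiag n. v p * Z p \<omega>)}
    \<le> exp (- (V / (8 * \<sigma>\<^sup>2)))"
proof -
  interpret prob_space M by fact
  have "0 \<le> V" unfolding V by (intro sum_nonneg) auto
  show ?thesis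
  proof (cases "V = 0")
    case True
    then show ?thesis by simp
  next
    case False
    with \<open>0 \<le> V\<close> have "0 < V" by simp
    define h where "h = sqrt V"
    have h: "0 < h" "h\<^sup>2 = V" using \<open>0 < V\<close> by (auto simp: h_def)
    let ?E = "{\<omega> \<in> space M. V / 2 \<le> (\<Sum>p\<in>offdiag n. v p * Z p \<omega>)}"
    have unit: "(\<Sum>p\<in>offdiag n. (v p / h)\<^sup>2) = 1"
      using h \<open>0 < V\<close> by (simp add: power_divide sum_divide_distrib[symmetric] V[symmetric])
    have below: "measure M ?E \<le> exp (- (t\<^sup>2 / (2 * \<sigma>\<^sup>2)))" if t: "0 < t" "t < h / 2" for t
    proof -
      let ?F = "{\<omega> \<in> space M. t < (\<Sum>p\<in>offdiag n. v p / h * Z p \<omega>)}"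
      have "(\<lambda>\<omega>. \<Sum>p\<in>offdiag n. v p / h * Z p \<omega>) \<in> borel_measurable M"
        using Z by (intro borel_measurable_sum borel_measurable_times) auto
      then have "?F \<in> sets M" by measurable
      moreover have "?E \<subseteq> ?F"
      proof safe
        fix \<omega> assume le: "V / 2 \<le> (\<Sum>p\<in>offdiag n. v p * Z p \<omega>)"
        have "t < h / 2" by fact
        also have "h / 2 = V / 2 / h"
          unfolding h(2)[symmetric] using h(1) by (simp add: power2_eq_square)
        also have "\<dots> \<le> (\<Sum>p\<in>offdiag n. v p * Z p \<omega>) / h"
          using le h by (intro divide_right_mono) auto
        finally show "t < (\<Sum>p\<in>offdiag n. v p / h * Z p \<omega>)"
          by (simp add: sum_divide_distrib)
      qed
      ultimately have "measure M ?E \<le> measure M ?F" by (intro finite_measure_mono)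
      also have "\<dots> \<le> exp (- (t\<^sup>2 / (2 * \<sigma>\<^sup>2)))"
        by (rule noise[unfolded noise_condition_def, rule_format, OF t(1) unit])
      finally show ?thesis .
    qed
    have lim: "((\<lambda>t. exp (- (t\<^sup>2 / (2 * \<sigma>\<^sup>2)))) \<longlongrightarrow> exp (- ((h / 2)\<^sup>2 / (2 * \<sigma>\<^sup>2)))) (at_left (h / 2))"
      using \<sigma> by (intro tendsto_intros) auto
    have "eventually (\<lambda>t. t \<in> {0<..<h / 2}) (at_left (h / 2))"
      using h by (intro eventually_at_leftI[of 0]) auto
    then have "eventually (\<lambda>t. measure M ?E \<le> exp (- (t\<^sup>2 / (2 * \<sigma>\<^sup>2)))) (at_left (h / 2))"
      by eventually_elim (use below in auto)
    from tendsto_lowerbound[OF lim this]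
    have "measure M ?E \<le> exp (- ((h / 2)\<^sup>2 / (2 * \<sigma>\<^sup>2)))" by simp
    also have "(h / 2)\<^sup>2 / (2 * \<sigma>\<^sup>2) = V / (8 * \<sigma>\<^sup>2)" using h by (simp add: power_divide)
    finally show ?thesis .
  qed
qed

lemma obs_map_measurable:
  assumes "\<forall>p\<in>offdiag n. Z p \<in> borel_measurable M"
  shows "(\<lambda>\<omega>. \<lambda>(i, j)\<in>offdiag n. \<mu> (r i) (r j) + Z (i, j) \<omega>) \<in> measurable M (obs_space n)"
  unfolding obs_space_def
proof (rule measurable_restrict)
  fix p assume "p \<in> offdiag n"
  with assms have "Z p \<in> borel_measurable M" by blast
  then show "(\<lambda>\<omega>. case p of (i, j) \<Rightarrow> \<mu> (r i) (r j) + Z (i, j) \<omega>) \<in> borel_measurable M"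
    by (cases p) auto
qed

lemma selection_prob_le:
  assumes "prob_space M" and Z: "\<forall>p\<in>offdiag n. Z p \<in> borel_measurable M"
    and \<sigma>: "0 < \<sigma>" and noise: "noise_condition n M Z \<sigma>"
    and signal: "signal_condition n c \<mu> \<beta>" and ls: "least_squares_estimator n c \<mu> rhat"
    and r: "r \<in> rank_space n c" and r': "r' \<in> rank_space n c"
  shows "measure (obs_law n M \<mu> Z r) {x \<in> space (obs_law n M \<mu> Z r). rhat x = r'}
    \<le> exp (- (real n * \<beta>\<^sup>2 / (4 * \<sigma>\<^sup>2)) * sq_dist n r' r)"
proof -
  interpret prob_space M by fact
  define T where "T = (\<lambda>\<omega>. \<lambda>(i, j)\<in>offdiag n. \<mu> (r i) (r j) + Z (i, j) \<omega>)"
  define v where "v = (\<lambda>(i, j). \<mu> (r' i) (r' j) - \<mu> (r i) (r j))"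
  define V where "V = (\<Sum>p\<in>offdiag n. (v p)\<^sup>2)"
  have T: "T \<in> measurable M (obs_space n)"
    unfolding T_def using Z by (rule obs_map_measurable)
  have law: "obs_law n M \<mu> Z r = distr M (obs_space n) T"
    unfolding obs_law_def T_def ..
  let ?E = "{x \<in> space (obs_space n). rhat x = r'}"
  let ?F = "{\<omega> \<in> space M. V / 2 \<le> (\<Sum>p\<in>offdiag n. v p * Z p \<omega>)}"
  have "rhat -` {r'} \<inter> space (obs_space n) \<in> sets (obs_space n)"
    using ls r' unfolding least_squares_estimator_def by (intro measurable_sets) auto
  also have "rhat -` {r'} \<inter> space (obs_space n) = ?E" by auto
  finally have E: "?E \<in> sets (obs_space n)" .
  have F: "?F \<in> sets M"
  proof -
    have "(\<lambda>\<omega>. \<Sum>p\<in>offdiag n. v p * Z p \<omega>) \<in> borel_measurable M"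
      using Z by (intro borel_measurable_sum borel_measurable_times) auto
    then show ?thesis by measurable
  qed
  have sub: "T -` ?E \<inter> space M \<subseteq> ?F"
  proof safe
    fix \<omega> assume \<omega>: "\<omega> \<in> space M" "T \<omega> \<in> space (obs_space n)" and sel: "r' = rhat (T \<omega>)"
    let ?obj = "\<lambda>\<rho>. \<Sum>(i, j)\<in>offdiag n. (T \<omega> (i, j) - \<mu> (\<rho> i) (\<rho> j))\<^sup>2"
    have "is_arg_min ?obj (\<lambda>r. r \<in> rank_space n c) r'"
      using ls \<omega>(2) sel unfolding least_squares_estimator_def by blast
    then have "?obj r' \<le> ?obj r"
      using r unfolding is_arg_min_def by (meson not_less)
    also have "?obj r = (\<Sum>p\<in>offdiag n. (Z p \<omega>)\<^sup>2)"
      by (intro sum.cong) (auto simp: T_def)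
    also have "?obj r' = (\<Sum>p\<in>offdiag n. (Z p \<omega> - v p)\<^sup>2)"
      by (intro sum.cong) (auto simp: T_def v_def algebra_simps)
    also have "\<dots> = (\<Sum>p\<in>offdiag n. (Z p \<omega>)\<^sup>2) + V - 2 * (\<Sum>p\<in>offdiag n. v p * Z p \<omega>)"
      unfolding V_def sum_distrib_left sum.distrib[symmetric] sum_subtractf[symmetric]
      by (intro sum.cong refl) (simp add: power2_diff algebra_simps)
    finally show "V / 2 \<le> (\<Sum>p\<in>offdiag n. v p * Z p \<omega>)" by simp
  qed
  have "measure (obs_law n M \<mu> Z r) {x \<in> space (obs_law n M \<mu> Z r). rhat x = r'}
      = measure M (T -` ?E \<inter> space M)"
    unfolding law using T E by (simp add: measure_distr)
  also have "\<dots> \<le> measure M ?F"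
    using sub F by (rule finite_measure_mono)
  also have "\<dots> \<le> exp (- (V / (8 * \<sigma>\<^sup>2)))"
    using assms(1) Z \<sigma> noise V_def by (rule noise_tail_le)
  also have "\<dots> \<le> exp (- (real n * \<beta>\<^sup>2 / (4 * \<sigma>\<^sup>2)) * sq_dist n r' r)"
  proof -
    have "2 * real n * \<beta>\<^sup>2 * sq_dist n r' r \<le> V"
      using signal r r' unfolding signal_condition_def L2_set_eq_sq_dist V_def v_def
      by (auto simp: case_prod_unfold)
    then have "2 * real n * \<beta>\<^sup>2 * sq_dist n r' r / (8 * \<sigma>\<^sup>2) \<le> V / (8 * \<sigma>\<^sup>2)"
      by (intro divide_right_mono) auto
    then show ?thesis by (simp add: mult_ac)
  qed
  finally show ?thesis .
qed

section \<open>Expected squared distance\<close>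

lemma (in prob_space) finite_range_expectation:
  fixes f :: "'b \<Rightarrow> real"
  assumes Y: "Y \<in> measurable M (count_space R)" and R: "finite R"
  shows "integrable M (\<lambda>x. f (Y x))"
    and "expectation (\<lambda>x. f (Y x)) = (\<Sum>y\<in>R. f y * prob {x \<in> space M. Y x = y})"
proof -
  have sets: "{x \<in> space M. Y x = y} \<in> sets M" if "y \<in> R" for y
  proof -
    have "Y -` {y} \<inter> space M \<in> sets M" using Y that by (intro measurable_sets) auto
    also have "Y -` {y} \<inter> space M = {x \<in> space M. Y x = y}" by auto
    finally show ?thesis .
  qed
  have eq: "f (Y x) = (\<Sum>y\<in>R. f y * indicator {x \<in> space M. Y x = y} x)" if "x \<in> space M" for x
  proof -
    have "Y x \<in> R" using measurable_space[OF Y that] by simp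
    have "(\<Sum>y\<in>R. f y * indicator {x \<in> space M. Y x = y} x) = (\<Sum>y\<in>R. if y = Y x then f y else 0)"
      using that by (intro sum.cong refl) (auto simp: indicator_def)
    also have "\<dots> = f (Y x)" using R \<open>Y x \<in> R\<close> by simp
    finally show ?thesis by simp
  qed
  have int: "integrable M (\<lambda>x. f y * indicator {x \<in> space M. Y x = y} x)" if "y \<in> R" for y
    using sets[OF that] by (intro integrable_mult_right integrable_real_indicator)
      (auto simp: emeasure_eq_measure)
  have "integrable M (\<lambda>x. \<Sum>y\<in>R. f y * indicator {x \<in> space M. Y x = y} x)"
    using int by (rule Bochner_Integration.integrable_sum)
  then show "integrable M (\<lambda>x. f (Y x))"
    using eq by (simp cong: Bochner_Integration.integrable_cong)
  have "expectation (\<lambda>x. f (Y x))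
      = expectation (\<lambda>x. \<Sum>y\<in>R. f y * indicator {x \<in> space M. Y x = y} x)"
    using eq by (intro Bochner_Integration.integral_cong) auto
  also have "\<dots> = (\<Sum>y\<in>R. expectation (\<lambda>x. f y * indicator {x \<in> space M. Y x = y} x))"
    using int by (rule Bochner_Integration.integral_sum)
  also have "\<dots> = (\<Sum>y\<in>R. f y * prob {x \<in> space M. Y x = y})"
    using sets by (intro sum.cong refl) (simp add: Int_absorb2 sets.sets_into_space)
  finally show "expectation (\<lambda>x. f (Y x)) = (\<Sum>y\<in>R. f y * prob {x \<in> space M. Y x = y})" .
qed

text \<open>If a finitely valued \<open>Y\<close> hits \<open>y\<close> with probability at most \<open>exp (- s D(y))\<close>, then
  \<open>exp (\<theta> D(Y))\<close> has expectation at most the partition sum at \<open>s - \<theta>\<close>, and Jensen's inequality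
  bounds \<open>\<theta>\<close> times the expectation of \<open>D(Y)\<close> by the logarithm of that sum.\<close>

lemma (in prob_space) expectation_le_ln_partition_sum:
  fixes D :: "'b \<Rightarrow> real"
  assumes Y: "Y \<in> measurable M (count_space R)" and R: "finite R"
    and tail: "\<And>y. y \<in> R \<Longrightarrow> prob {x \<in> space M. Y x = y} \<le> exp (- s * D y)"
    and G: "(\<Sum>y\<in>R. exp (- (s - \<theta>) * D y)) \<le> G" "0 < G"
  shows "\<theta> * expectation (\<lambda>x. D (Y x)) \<le> ln G"
proof -
  note int = finite_range_expectation(1)[OF Y R]
  have "expectation (\<lambda>x. exp (\<theta> * D (Y x)))
      = (\<Sum>y\<in>R. exp (\<theta> * D y) * prob {x \<in> space M. Y x = y})"
    by (rule finite_range_expectation(2)[OF Y R])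
  also have "\<dots> \<le> (\<Sum>y\<in>R. exp (\<theta> * D y) * exp (- s * D y))"
    using tail by (intro sum_mono mult_left_mono) auto
  also have "\<dots> = (\<Sum>y\<in>R. exp (- (s - \<theta>) * D y))"
    by (simp add: exp_add[symmetric] algebra_simps)
  also note G(1)
  finally have mgf: "expectation (\<lambda>x. exp (\<theta> * D (Y x))) \<le> G" .
  have "\<theta> * expectation (\<lambda>x. D (Y x)) = expectation (\<lambda>x. \<theta> * D (Y x))"
    by simp
  also have "\<dots> \<le> expectation (\<lambda>x. ln G - 1 + exp (\<theta> * D (Y x)) / G)"
  proof (rule integral_mono)
    show "integrable M (\<lambda>x. \<theta> * D (Y x))" by (rule int)
    show "integrable M (\<lambda>x. ln G - 1 + exp (\<theta> * D (Y x)) / G)" by (rule int)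
    fix x
    \<comment> \<open>the tangent of \<open>exp\<close> at \<open>ln G\<close>\<close>
    have "1 + (\<theta> * D (Y x) - ln G) \<le> exp (\<theta> * D (Y x) - ln G)"
      by (rule exp_ge_add_one_self)
    also have "\<dots> = exp (\<theta> * D (Y x)) / G" using G(2) by (simp add: exp_diff)
    finally show "\<theta> * D (Y x) \<le> ln G - 1 + exp (\<theta> * D (Y x)) / G" by simp
  qed
  also have "\<dots> = ln G - 1 + expectation (\<lambda>x. exp (\<theta> * D (Y x))) / G"
    using int[of "\<lambda>y. exp (\<theta> * D y) / G"] by (simp add: prob_space)
  also have "\<dots> \<le> ln G" using mgf G(2) by simp
  finally show ?thesis .
qed

lemma obs_law_prob_space:
  assumes "prob_space M" "\<forall>p\<in>offdiag n. Z p \<in> borel_measurable M"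
  shows "prob_space (obs_law n M \<mu> Z r)"
  unfolding obs_law_def using assms obs_map_measurable by (intro prob_space.prob_space_distr)

lemma estimator_measurable:
  assumes "least_squares_estimator n c \<mu> rhat"
  shows "rhat \<in> measurable (obs_law n M \<mu> Z r) (count_space (rank_space n c))"
  using assms unfolding least_squares_estimator_def obs_law_def by simp

lemma expected_sq_dist_le:
  assumes M: "prob_space M" and Z: "\<forall>p\<in>offdiag n. Z p \<in> borel_measurable M"
    and \<sigma>: "0 < \<sigma>" and noise: "noise_condition n M Z \<sigma>"
    and signal: "signal_condition n c \<mu> \<beta>" and ls: "least_squares_estimator n c \<mu> rhat"
    and r: "r \<in> rank_space n c"
    and s: "s = real n * \<beta>\<^sup>2 / (4 * \<sigma>\<^sup>2)" and \<theta>: "0 < \<theta>" "\<theta> < s"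
  shows "(\<integral>x. sq_dist n (rhat x) r \<partial>(obs_law n M \<mu> Z r))
    \<le> real n * ln (1 + 2 / (exp (s - \<theta>) - 1)) / \<theta>"
proof -
  interpret N: prob_space "obs_law n M \<mu> Z r" using M Z by (rule obs_law_prob_space)
  let ?g = "1 + 2 / (exp (s - \<theta>) - 1)"
  have g: "0 < ?g" using \<theta> by (simp add: add_pos_nonneg)
  have "\<theta> * (\<integral>x. sq_dist n (rhat x) r \<partial>(obs_law n M \<mu> Z r)) \<le> ln (?g ^ n)"
  proof (rule N.expectation_le_ln_partition_sum
      [where Y = rhat and R = "rank_space n c" and s = s and D = "\<lambda>r'. sq_dist n r' r"])
    show "rhat \<in> measurable (obs_law n M \<mu> Z r) (count_space (rank_space n c))"
      using ls by (rule estimator_measurable)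
    show "finite (rank_space n c)" by (rule finite_rank_space)
    show "(\<Sum>r'\<in>rank_space n c. exp (- (s - \<theta>) * sq_dist n r' r)) \<le> ?g ^ n"
      using \<theta> by (intro sum_exp_sq_dist_le) simp
    show "0 < ?g ^ n" using g by simp
    show "measure (obs_law n M \<mu> Z r) {x \<in> space (obs_law n M \<mu> Z r). rhat x = r'}
        \<le> exp (- s * sq_dist n r' r)" if "r' \<in> rank_space n c" for r'
      unfolding s using M Z \<sigma> noise signal ls r that by (rule selection_prob_le)
  qed
  also have "ln (?g ^ n) = real n * ln ?g" using g by (simp add: ln_realpow)
  finally show ?thesis using \<theta> by (simp add: field_simps)
qed

section \<open>The two regimes\<close>

lemma ln_bound_large:
  fixes s :: real
  assumes "1 < s"
  shows "ln (1 + 2 / (exp (s - 1 / 2) - 1)) / (1 / 2) \<le> 24 * exp (- s)"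
proof -
  have sqrt_e: "exp (1 / 2 :: real) \<le> 2"
  proof (rule power2_le_imp_le)
    have "(exp (1 / 2 :: real))\<^sup>2 = exp 1" by (simp add: exp_double[symmetric])
    then show "(exp (1 / 2 :: real))\<^sup>2 \<le> 2\<^sup>2" using exp_le by simp
  qed simp
  have "3 / 2 \<le> 1 + (s - 1 / 2)" using assms by simp
  also have "\<dots> \<le> exp (s - 1 / 2)" by (rule exp_ge_add_one_self)
  finally have big: "3 / 2 \<le> exp (s - 1 / 2)" .
  have "ln (1 + 2 / (exp (s - 1 / 2) - 1)) \<le> 2 / (exp (s - 1 / 2) - 1)"
    using assms by (intro ln_add_one_self_le_self) auto
  also have "\<dots> \<le> 2 / (exp (s - 1 / 2) / 3)"
    using big by (intro divide_left_mono mult_pos_pos) linarith+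
  also have "\<dots> = 6 * (exp (1 / 2) * exp (- s))"
  proof -
    have e: "exp (1 / 2) * exp (- s) = inverse (exp (s - 1 / 2))"
      by (simp add: exp_minus[symmetric] exp_add[symmetric])
    show ?thesis unfolding e by (simp add: inverse_eq_divide)
  qed
  also have "\<dots> \<le> 6 * (2 * exp (- s))"
    using sqrt_e by (intro mult_left_mono mult_right_mono) auto
  finally show ?thesis by simp
qed

lemma ln_bound_small:
  fixes s :: real
  assumes "0 < s" "s \<le> 1"
  shows "ln (1 + 2 / (exp (s / 2) - 1)) / (s / 2) \<le> 6 * (inverse s * max 1 (ln (inverse s)))"
proof -
  have "1 + s / 2 \<le> exp (s / 2)" by (rule exp_ge_add_one_self)
  then have "2 / (exp (s / 2) - 1) \<le> 2 / (s / 2)"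
    using assms by (intro divide_left_mono mult_pos_pos) linarith+
  also have "2 / (s / 2) = 4 * inverse s" by (simp add: inverse_eq_divide)
  finally have "1 + 2 / (exp (s / 2) - 1) \<le> 5 * inverse s"
    using one_le_inverse[OF assms] by linarith
  moreover have "0 < 1 + 2 / (exp (s / 2) - 1)" using assms by (simp add: add_pos_nonneg)
  ultimately have "ln (1 + 2 / (exp (s / 2) - 1)) \<le> ln (5 * inverse s)"
    by (intro ln_mono) auto
  also have "\<dots> = ln 5 + ln (inverse s)" using assms by (intro ln_mult_pos) auto
  also have "ln (5::real) \<le> 2"
  proof -
    have "5 \<le> 1 + 2 + (2::real)\<^sup>2 / 2" by simp
    also have "\<dots> \<le> exp 2" by (rule exp_lower_Taylor_quadratic) simp
    finally have "ln (5::real) \<le> ln (exp 2)" by (intro ln_mono) auto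
    then show ?thesis by simp
  qed
  finally have "ln (1 + 2 / (exp (s / 2) - 1)) \<le> 3 * max 1 (ln (inverse s))" by linarith
  then show ?thesis using assms by (simp add: field_simps)
qed

lemma expected_loss_le_rate:
  assumes q: "0 \<le> q" "q \<le> 2" and n: "1 \<le> n"
    and M: "prob_space M" and Z: "\<forall>p\<in>offdiag n. Z p \<in> borel_measurable M"
    and \<sigma>: "0 < \<sigma>" and noise: "noise_condition n M Z \<sigma>"
    and signal: "signal_condition n c \<mu> \<beta>" and ls: "least_squares_estimator n c \<mu> rhat"
    and r: "r \<in> rank_space n c"
  shows "(\<integral>x. loss q n (rhat x) r \<partial>(obs_law n M \<mu> Z r))
    \<le> 24 * rate q n 0 (real n * \<beta>\<^sup>2 / (4 * \<sigma>\<^sup>2))"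
proof -
  interpret N: prob_space "obs_law n M \<mu> Z r" using M Z by (rule obs_law_prob_space)
  define s where "s = real n * \<beta>\<^sup>2 / (4 * \<sigma>\<^sup>2)"
  let ?D = "N.expectation (\<lambda>x. sq_dist n (rhat x) r)"
  let ?L = "N.expectation (\<lambda>x. loss q n (rhat x) r)"
  note meas = estimator_measurable[OF ls, of M Z r]
  note int = N.finite_range_expectation(1)[OF meas finite_rank_space]
  note exp_D = expected_sq_dist_le[OF M Z \<sigma> noise signal ls r s_def]
  have "0 \<le> s" unfolding s_def by simp
  have triv: "?L \<le> real n powr q"
  proof -
    have "?L \<le> N.expectation (\<lambda>x. real n powr q)"
    proof (rule integral_mono)
      fix x assume "x \<in> space (obs_law n M \<mu> Z r)"
      then have "rhat x \<in> rank_space n c" using measurable_space[OF meas] by simp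
      with q n r show "loss q n (rhat x) r \<le> real n powr q" by (intro loss_le_powr)
    qed (auto intro: int)
    then show ?thesis by (simp add: N.prob_space)
  qed
  consider "s > 1" | "s = 0" | "0 < s" "s \<le> 1" using \<open>0 \<le> s\<close> by linarith
  then have "?L \<le> 24 * rate q n 0 s"
  proof cases
    case 1
    have "?L \<le> N.expectation (\<lambda>x. sq_dist n (rhat x) r / real n)"
      using q by (intro integral_mono int loss_le_sq_dist)
    also have "\<dots> = ?D / real n" by simp
    also have "\<dots> \<le> (real n * ln (1 + 2 / (exp (s - 1 / 2) - 1)) / (1 / 2)) / real n"
      using exp_D[of "1 / 2"] 1 by (intro divide_right_mono) auto
    also have "\<dots> = ln (1 + 2 / (exp (s - 1 / 2) - 1)) / (1 / 2)" using n by simp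
    also have "\<dots> \<le> 24 * exp (- s)" using 1 by (rule ln_bound_large)
    finally show ?thesis using 1 by (simp add: rate_def)
  next
    case 2
    have "0 \<le> real n powr q" by simp
    with triv have "?L \<le> 24 * real n powr q" by linarith
    with 2 show ?thesis by (simp add: rate_def)
  next
    case 3
    define w where "w = inverse s * max 1 (ln (inverse s))"
    have w: "0 < w" using 3 by (simp add: w_def)
    have "?D \<le> real n * ln (1 + 2 / (exp (s - s / 2) - 1)) / (s / 2)"
      using exp_D[of "s / 2"] 3 by auto
    also have "\<dots> = real n * (ln (1 + 2 / (exp (s / 2) - 1)) / (s / 2))" by simp
    also have "\<dots> \<le> real n * (6 * w)"
      unfolding w_def using ln_bound_small[OF 3] by (intro mult_left_mono) auto
    finally have D: "?D \<le> real n * (6 * w)" .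
    have "?L \<le> N.expectation (\<lambda>x. (6 * w) powr (q / 2) * (1 + sq_dist n (rhat x) r / (real n * (6 * w))))"
      using q n w by (intro integral_mono int loss_le_affine_sq_dist) auto
    also have "\<dots> = (6 * w) powr (q / 2) * (1 + ?D / (real n * (6 * w)))"
      using int[of "\<lambda>r'. sq_dist n r' r / (real n * (6 * w))"] by (simp add: N.prob_space)
    also have "\<dots> \<le> (6 * w) powr (q / 2) * 2"
    proof -
      have "?D / (real n * (6 * w)) \<le> 1" using D n w by (simp add: divide_le_eq)
      then show ?thesis by (intro mult_left_mono) auto
    qed
    also have "\<dots> = 2 * 6 powr (q / 2) * w powr (q / 2)" using w by (simp add: powr_mult)
    also have "\<dots> \<le> 24 * w powr (q / 2)"
    proof -
      have "6 powr (q / 2) \<le> (6::real) powr 1" using q by (intro powr_mono) auto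
      then show ?thesis by (intro mult_right_mono) auto
    qed
    finally have "?L \<le> 24 * w powr (q / 2)" .
    moreover have "?L \<le> 24 * real n powr q"
    proof -
      have "0 \<le> real n powr q" by simp
      with triv show ?thesis by linarith
    qed
    ultimately have "?L \<le> 24 * min (w powr (q / 2)) (real n powr q)" by (simp add: min_def)
    with 3 show ?thesis by (simp add: rate_def w_def)
  qed
  then show ?thesis unfolding s_def .
qed

theorem theorem2p1:
  fixes q :: real and c :: "nat \<Rightarrow> real"
  assumes "0 \<le> q" and "q \<le> 2"
    and "\<And>n. n \<ge> 1 \<Longrightarrow> 1 \<le> c n"
    and "c \<in> o(\<lambda>n. sqrt (real n))"
  shows "\<exists>C>0. \<exists>\<delta> :: nat \<Rightarrow> real. \<delta> \<longlonglongrightarrow> 0 \<and>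
    (\<forall>n\<ge>1. \<forall>(M :: 'a measure) \<mu> Z \<sigma> \<beta> rhat.
      prob_space M \<longrightarrow>
      (\<forall>p\<in>offdiag n. Z p \<in> borel_measurable M) \<longrightarrow>
      \<sigma> > 0 \<longrightarrow>
      noise_condition n M Z \<sigma> \<longrightarrow>
      signal_condition n (c n) \<mu> \<beta> \<longrightarrow>
      least_squares_estimator n (c n) \<mu> rhat \<longrightarrow>
      max_risk q n (c n) M \<mu> Z rhat \<le> C * rate q n (\<delta> n) (real n * \<beta>\<^sup>2 / (4 * \<sigma>\<^sup>2)))"
proof -
  have "max_risk q n (c n) M \<mu> Z rhat \<le> 24 * rate q n 0 (real n * \<beta>\<^sup>2 / (4 * \<sigma>\<^sup>2))"
    if "1 \<le> n" "prob_space M" "\<forall>p\<in>offdiag n. Z p \<in> borel_measurable M" "\<sigma> > 0"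
      "noise_condition n M Z \<sigma>" "signal_condition n (c n) \<mu> \<beta>"
      "least_squares_estimator n (c n) \<mu> rhat"
    for n \<mu> Z \<sigma> \<beta> rhat and M :: "'a measure"
    unfolding max_risk_def
  proof (rule cSUP_least)
    show "rank_space n (c n) \<noteq> {}"
      using assms(3)[OF \<open>1 \<le> n\<close>] by (intro rank_space_nonempty) simp
  qed (use assms(1,2) that in \<open>rule expected_loss_le_rate\<close>)
  then show ?thesis
    by (intro exI[of _ "24 :: real"] exI[of _ "\<lambda>_. 0 :: real"]) auto
qed

end
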